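(* Let ${\mathcal C}$ be a subcategory of $\mathbf{Top}$. Then the following are equivalent: 1) ${\mathcal C}$ is an epireflective subcategory of $\mathbf{Top}$, closed under bimorphic images. 2) Either $\mathrm{Ob}\,{\mathcal C}=\{X\in \mathrm{Ob}\,\mathbf{Top}\mid |X|\le 1\}$, or $\mathrm{Ob}\,{\mathcal C}=\{X\in \mathrm{Ob}\,\mathbf{Top}\mid X \text{ is indiscrete}\}$, or ${\mathcal C}=\mathbf{Top}$. Moreover, if 1) is written as the conjunction of the three properties: closedness under products, closedness under extremal subobjects, and closedness under bimorphic images, then none of these three properties can be omitted without invalidating the implication $1)\Rightarrow 2)$ (that is, for each of the three properties there is a subcategory of $\mathbf{Top}$ having the other two properties but not of the form in 2)).
   Context: $\mathbf{Top}$ is the category of all topological spaces and continuous maps (no separation axiom). Subcategories are always full and isomorphism closed, and are identified with the classes of their objects. A subcategory is epireflective if it is reflective with all reflection arrows epimorphisms of the ambient category; in $\mathbf{Top}$ this is equivalent to being closed under products (including the empty product) and extremal subobjects. In $\mathbf{Top}$ the epimorphisms are the surjective morphisms, the bimorphisms are the bijective morphisms, and the extremal monomorphisms are the embeddings (so extremal subobjects are the subspaces). For a class $\mathbf{E}$ of epimorphisms, ${\mathcal C}$ is closed under $\mathbf{E}$-images if $C\in\mathrm{Ob}\,{\mathcal C}$ and $e:C\to D$ with $e\in\mathbf{E}$ imply $D\in \mathrm{Ob}\,{\mathcal C}$; bimorphic images correspond to $\mathbf E$ being the class of bimorphisms. *)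

theory Defs
  imports "HOL-Analysis.Analysis"
begin

text \<open>
  HOL has no type of all topological spaces, so the category of all spaces is formed relative to a
  Grothendieck universe, given by a type \<open>'u\<close>: a set is small if it has fewer elements
  than \<open>'u\<close>, and small sets are closed under power sets and small unions.  In other words,
  the cardinality of \<open>'u\<close> is a regular strong limit.  For \<open>'u\<close> of the size of the class of
  all sets, the small spaces are, up to homeomorphism, all topological spaces.  An axiom of
  infinity is not imposed on the universe, so \<open>nat\<close> (with finite = small) is an instance too.
\<close>

definition small :: "'u set \<Rightarrow> bool"
  where "small A \<longleftrightarrow> A \<prec> (UNIV :: 'u set)"

definition universe :: "'u itself \<Rightarrow> bool"
  where "universe (_ :: 'u itself) \<longleftrightarrow>
    (\<forall>A :: 'u set. small A \<longrightarrow> Pow A \<prec> (UNIV :: 'u set)) \<and>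
    (\<forall>(I :: 'u set) (A :: 'u \<Rightarrow> 'u set).
       small I \<and> (\<forall>i\<in>I. small (A i)) \<longrightarrow> small (\<Union>i\<in>I. A i))"

definition Top :: "'u topology set"
  where "Top = {X. small (topspace X)}"

text \<open>
  A morphism of \<open>X\<close> to \<open>Y\<close> is a continuous map up to its values outside \<open>topspace X\<close>;
  accordingly, morphisms are only ever compared on the carrier of their domain.
\<close>

definition epimorphism :: "'u topology \<Rightarrow> 'u topology \<Rightarrow> ('u \<Rightarrow> 'u) \<Rightarrow> bool"
  where "epimorphism X Y f \<longleftrightarrow> continuous_map X Y f \<and>
    (\<forall>Z\<in>(Top :: 'u topology set). \<forall>g h. continuous_map Y Z g \<and> continuous_map Y Z h \<and>
       (\<forall>x\<in>topspace X. g (f x) = h (f x)) \<longrightarrow> (\<forall>y\<in>topspace Y. g y = h y))"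

definition monomorphism :: "'u topology \<Rightarrow> 'u topology \<Rightarrow> ('u \<Rightarrow> 'u) \<Rightarrow> bool"
  where "monomorphism X Y f \<longleftrightarrow> continuous_map X Y f \<and>
    (\<forall>Z\<in>(Top :: 'u topology set). \<forall>g h. continuous_map Z X g \<and> continuous_map Z X h \<and>
       (\<forall>z\<in>topspace Z. f (g z) = f (h z)) \<longrightarrow> (\<forall>z\<in>topspace Z. g z = h z))"

definition bimorphism :: "'u topology \<Rightarrow> 'u topology \<Rightarrow> ('u \<Rightarrow> 'u) \<Rightarrow> bool"
  where "bimorphism X Y f \<longleftrightarrow> monomorphism X Y f \<and> epimorphism X Y f"

definition extremal_monomorphism :: "'u topology \<Rightarrow> 'u topology \<Rightarrow> ('u \<Rightarrow> 'u) \<Rightarrow> bool"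
  where "extremal_monomorphism X Y m \<longleftrightarrow> monomorphism X Y m \<and>
    (\<forall>Z\<in>(Top :: 'u topology set). \<forall>e f. epimorphism X Z e \<and> continuous_map Z Y f \<and>
       (\<forall>x\<in>topspace X. m x = f (e x)) \<longrightarrow> homeomorphic_map X Z e)"

text \<open>Full isomorphism closed subcategories, as classes of objects.\<close>

definition subcategory :: "'u topology set \<Rightarrow> bool"
  where "subcategory C \<longleftrightarrow> C \<subseteq> Top \<and>
    (\<forall>X\<in>C. \<forall>Y\<in>Top. X homeomorphic_space Y \<longrightarrow> Y \<in> C)"

definition reflection_arrow ::
    "'u topology set \<Rightarrow> 'u topology \<Rightarrow> 'u topology \<Rightarrow> ('u \<Rightarrow> 'u) \<Rightarrow> bool"
  where "reflection_arrow C X R r \<longleftrightarrow> R \<in> C \<and> continuous_map X R r \<and>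
    (\<forall>D\<in>C. \<forall>f. continuous_map X D f \<longrightarrow>
       (\<exists>g. continuous_map R D g \<and> (\<forall>x\<in>topspace X. g (r x) = f x) \<and>
          (\<forall>h. continuous_map R D h \<and> (\<forall>x\<in>topspace X. h (r x) = f x) \<longrightarrow>
             (\<forall>y\<in>topspace R. h y = g y))))"

definition reflective :: "'u topology set \<Rightarrow> bool"
  where "reflective C \<longleftrightarrow> (\<forall>X\<in>Top. \<exists>R r. reflection_arrow C X R r)"

definition epireflective :: "'u topology set \<Rightarrow> bool"
  where "epireflective C \<longleftrightarrow> reflective C \<and>
    (\<forall>X\<in>Top. \<forall>R r. reflection_arrow C X R r \<longrightarrow> epimorphism X R r)"

text \<open>
  The carrier of \<open>product_topology X I\<close> consists of functions on \<open>I\<close>, so a product in the category of small spaces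
  is any small space homeomorphic to it.  The empty product is the case \<open>I = {}\<close>.
\<close>

definition closed_under_products :: "'u topology set \<Rightarrow> bool"
  where "closed_under_products C \<longleftrightarrow>
    (\<forall>(I :: 'u set) (X :: 'u \<Rightarrow> 'u topology). \<forall>P\<in>Top.
       small I \<and> (\<forall>i\<in>I. X i \<in> C) \<and> P homeomorphic_space product_topology X I \<longrightarrow> P \<in> C)"

definition closed_under_extremal_subobjects :: "'u topology set \<Rightarrow> bool"
  where "closed_under_extremal_subobjects C \<longleftrightarrow>
    (\<forall>X\<in>C. \<forall>S\<in>Top. (\<exists>m. extremal_monomorphism S X m) \<longrightarrow> S \<in> C)"

definition closed_under_images ::
    "('u topology \<Rightarrow> 'u topology \<Rightarrow> ('u \<Rightarrow> 'u) \<Rightarrow> bool) \<Rightarrow> 'u topology set \<Rightarrow> bool"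
  where "closed_under_images E C \<longleftrightarrow>
    (\<forall>X\<in>C. \<forall>Y\<in>Top. (\<exists>e. E X Y e) \<longrightarrow> Y \<in> C)"

definition subsingleton_spaces :: "'u topology set"
  where "subsingleton_spaces = {X \<in> Top. finite (topspace X) \<and> card (topspace X) \<le> 1}"

definition indiscrete_spaces :: "'u topology set"
  where "indiscrete_spaces = {X \<in> Top. \<forall>U. openin X U \<longrightarrow> U = {} \<or> U = topspace X}"

end

theory Submission
  imports Defs
begin

text \<open>
  Closedness under bimorphic images turns a two-point subspace into the indiscrete or, if one of
  its two points is open, into the Sierpinski space.  A space \<open>X\<close> embeds into a product of two-point
  spaces indexed by all subsets \<open>A\<close> of \<open>X\<close>, via the maps distinguishing \<open>A\<close> from its complement:
  the factor is the Sierpinski space if \<open>A\<close> is open and nontrivial, and indiscrete otherwise.  So a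
  class with the three closure properties that contains a space with two points contains all
  indiscrete spaces, and all spaces as soon as it contains one that is not indiscrete.
\<close>

section \<open>Spaces with few open sets\<close>

definition indiscrete_topology :: "'a set \<Rightarrow> 'a topology"
  where "indiscrete_topology A = topology (\<lambda>U. U = {} \<or> U = A)"

definition sierpinski_topology :: "'a \<Rightarrow> 'a \<Rightarrow> 'a topology"
  where "sierpinski_topology a b = topology (\<lambda>U. U = {} \<or> U = {a} \<or> U = {a, b})"

lemma openin_indiscrete_topology [simp]:
  "openin (indiscrete_topology A) U \<longleftrightarrow> U = {} \<or> U = A"
proof -
  have "istopology (\<lambda>U. U = {} \<or> U = A)"
    unfolding istopology_def by (intro conjI allI impI; blast)
  then show ?thesis
    unfolding indiscrete_topology_def by (simp add: topology_inverse')
qed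

lemma topspace_indiscrete_topology [simp]: "topspace (indiscrete_topology A) = A"
  by (auto simp: topspace_def)

lemma openin_sierpinski_topology [simp]:
  "openin (sierpinski_topology a b) U \<longleftrightarrow> U = {} \<or> U = {a} \<or> U = {a, b}"
proof -
  have "istopology (\<lambda>U. U = {} \<or> U = {a} \<or> U = {a, b})"
    unfolding istopology_def by (intro conjI allI impI; blast)
  then show ?thesis
    unfolding sierpinski_topology_def by (simp add: topology_inverse')
qed

lemma topspace_sierpinski_topology [simp]: "topspace (sierpinski_topology a b) = {a, b}"
  unfolding topspace_def openin_sierpinski_topology by blast

lemma continuous_map_indiscrete_topology [simp]:
  "continuous_map X (indiscrete_topology A) f \<longleftrightarrow> f \<in> topspace X \<rightarrow> A"
proof -
  have "{x \<in> topspace X. f x \<in> A} = topspace X" if "f \<in> topspace X \<rightarrow> A"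
    using that by auto
  then show ?thesis
    by (auto simp: continuous_map_def)
qed

text \<open>Each coordinate is continuous: over an indiscrete factor this costs nothing, and over a
  Sierpinski factor the preimage of the open point \<open>a\<close> is the open set
  \<open>D i\<close> itself. Coordinates of singletons separate points, and coordinates of
  nontrivial open sets make the map open onto its image. The index set is any \<open>J\<close> with
  a map \<open>D\<close> onto the subsets, so that it can later be chosen inside the
  universe.\<close>

lemma embedding_map_into_two_point_product:
  fixes X :: "'a topology" and D :: "'i \<Rightarrow> 'a set" and a b :: 'c
  assumes "a \<noteq> b" and D: "D ` J = Pow (topspace X)"
  defines "Y \<equiv> \<lambda>i. if openin X (D i) \<and> D i \<noteq> {} \<and> D i \<noteq> topspace X
      then sierpinski_topology a b else indiscrete_topology {a, b}"
  shows "embedding_map X (product_topology Y J) (\<lambda>x. \<lambda>i\<in>J. if x \<in> D i then a else b)"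
    (is "embedding_map X ?P ?f")
  unfolding embedding_map_def
proof (rule bijective_open_imp_homeomorphic_map)
  have Y: "topspace (Y i) = {a, b}" for i
    by (simp add: Y_def)
  have "continuous_map X (Y i) (\<lambda>x. if x \<in> D i then a else b)" if "i \<in> J" for i
  proof -
    have "D i \<subseteq> topspace X"
      using D that by auto
    then have "{x \<in> topspace X. (if x \<in> D i then a else b) = a} = D i"
      using \<open>a \<noteq> b\<close> by auto
    moreover have "{x \<in> topspace X. (if x \<in> D i then a else b) \<in> {a, b}} = topspace X"
      by auto
    ultimately show ?thesis
      by (auto simp: Y_def continuous_map_def)
  qed
  then have cont: "continuous_map X ?P ?f"
    by (auto simp: continuous_map_componentwise)
  then show "continuous_map X (subtopology ?P (?f ` topspace X)) ?f"
    by (simp add: continuous_map_into_subtopology)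
  have into: "?f ` topspace X \<subseteq> topspace ?P"
    using cont continuous_map_image_subset_topspace by blast
  then show "?f ` topspace X = topspace (subtopology ?P (?f ` topspace X))"
    by (simp only: topspace_subtopology) blast
  show "inj_on ?f (topspace X)"
  proof (rule inj_onI)
    fix x y assume xy: "x \<in> topspace X" "y \<in> topspace X" "?f x = ?f y"
    \<comment> \<open>The coordinate belonging to the set {x} takes the value \<open>a\<close> at x
      only. This argument concerns values alone, so it does not matter which topology that factor
      carries.\<close>
    then obtain i where "i \<in> J" "D i = {x}"
      using D by (metis (no_types, opaque_lifting) Pow_iff bot.extremum image_iff insert_subset)
    then show "x = y"
      using fun_cong [OF xy(3), of i] \<open>a \<noteq> b\<close> by (auto split: if_splits)
  qed
  show "open_map X (subtopology ?P (?f ` topspace X)) ?f"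
    unfolding open_map_def
  proof (intro allI impI)
    fix U assume U: "openin X U"
    show "openin (subtopology ?P (?f ` topspace X)) (?f ` U)"
    \<comment> \<open>The trivial open sets have indiscrete factors and are treated directly; every
      other open set has a Sierpinski factor of its own.\<close>
    proof (cases "U = {} \<or> U = topspace X")
      case True
      then show ?thesis
        using into by (auto simp: openin_subtopology_refl)
    next
      case False
      obtain i where i: "i \<in> J" "D i = U"
        using D U openin_subset by (metis Pow_iff image_iff)
      have "Y i = sierpinski_topology a b"
        using i U False by (simp add: Y_def)
      then have "openin (Y i) {a}"
        by simp
      then have "openin ?P {g \<in> topspace ?P. g i \<in> {a}}"
        using openin_continuous_map_preimage [OF continuous_map_product_projection [OF i(1)]]
        by blast
      \<comment> \<open>A point of the image has i-th coordinate \<open>a\<close> exactly when it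
        comes from a point of \<open>U\<close>, so the image of \<open>U\<close> is the trace of a
        subbasic open set of the product.\<close>
      moreover have "?f ` U = {g \<in> topspace ?P. g i \<in> {a}} \<inter> ?f ` topspace X"
        using i into openin_subset [OF U] \<open>a \<noteq> b\<close> by (auto split: if_splits)
      ultimately show ?thesis
        unfolding openin_subtopology by blast
    qed
  qed
qed

text \<open>Transport of structure: the image carries the topology pulled back along the inverse
  \<open>?d\<close> of \<open>e\<close>. It serves to replace a product, whose points are functions,
  by a homeomorphic space whose points lie in the universe.\<close>

lemma homeomorphic_map_onto_injective_image:
  assumes e: "inj_on e (topspace X)"
  obtains Y where "topspace Y = e ` topspace X" "homeomorphic_map X Y e"
proof -
  let ?A = "topspace X"
  let ?d = "inv_into ?A e"
  define Y where "Y = pullback_topology (e ` ?A) ?d X"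
  have d: "?d (e x) = x" if "x \<in> ?A" for x
    using e that by simp
  have top: "topspace Y = e ` ?A"
    using d by (auto simp: Y_def topspace_pullback_topology)
  have "continuous_map X Y e"
    unfolding continuous_map_def
  proof (intro conjI allI impI)
    fix V assume "openin Y V"
    then obtain U where U: "openin X U" "V = ?d -` U \<inter> e ` ?A"
      by (auto simp: Y_def openin_pullback_topology)
    then have "{x \<in> ?A. e x \<in> V} = U"
      using d openin_subset [OF U(1)] by (auto simp: subset_iff dest: inj_onD [OF e])
    then show "openin X {x \<in> ?A. e x \<in> V}"
      using U by simp
  qed (auto simp: top)
  moreover have "open_map X Y e"
    unfolding open_map_def
  proof (intro allI impI)
    fix U assume U: "openin X U"
    have "e ` U = ?d -` U \<inter> e ` ?A"
      using d openin_subset [OF U] by (auto simp: image_iff subset_iff dest: inj_onD [OF e])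
    then show "openin Y (e ` U)"
      using U by (auto simp: Y_def openin_pullback_topology)
  qed
  ultimately show thesis
    using that top e bijective_open_imp_homeomorphic_map by metis
qed

text \<open>A function with values in a doubleton is determined by the set on which it takes the
  value \<open>a\<close>. This bounds the carrier of a product of two-point spaces.\<close>

lemma PiE_doubleton_lepoll_Pow: "(\<Pi>\<^sub>E i\<in>J. {a, b}) \<lesssim> Pow J"
proof -
  have "inj_on (\<lambda>f. {i \<in> J. f i = a}) (\<Pi>\<^sub>E i\<in>J. {a, b})"
  proof (intro inj_onI PiE_ext)
    fix f g i
    assume "f \<in> (\<Pi>\<^sub>E i\<in>J. {a, b})" "g \<in> (\<Pi>\<^sub>E i\<in>J. {a, b})" "i \<in> J"
      "{i \<in> J. f i = a} = {i \<in> J. g i = a}"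
    then have "f i \<in> {a, b}" "g i \<in> {a, b}" "f i = a \<longleftrightarrow> g i = a"
      by (auto simp: set_eq_iff)
    then show "f i = g i"
      by auto
  qed auto
  then show ?thesis
    by (rule inj_on_image_eqpoll_self [THEN eqpoll_sym, THEN eqpoll_imp_lepoll, THEN lepoll_trans])
      (auto intro!: subset_imp_lepoll)
qed

section \<open>Morphisms of small spaces\<close>

text \<open>In a universe of n+1 elements, a set of n elements would be small, and closedness under
  power sets would give 2^n < n+1, contrary to n < 2^n.\<close>

lemma infinite_universe:
  assumes "universe TYPE('u)"
  shows "infinite (UNIV :: 'u set)"
proof
  assume fin: "finite (UNIV :: 'u set)"
  obtain u :: 'u where True by simp
  define A where "A = UNIV - {u}"
  have finA: "finite A"
    using fin by (simp add: A_def)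
  have card: "card (UNIV :: 'u set) = Suc (card A)"
    using fin card_Suc_Diff1 [of UNIV u] by (simp add: A_def)
  have "\<not> (UNIV :: 'u set) \<lesssim> A"
    using fin finA card by (simp add: lepoll_iff_card_le)
  then have "small A"
    unfolding small_def lesspoll_def
    by (metis eqpoll_imp_lepoll eqpoll_sym subset_imp_lepoll subset_UNIV)
  then have "Pow A \<prec> (UNIV :: 'u set)"
    using assms by (simp add: universe_def)
  then have "card (Pow A) \<le> card (UNIV :: 'u set)" "\<not> Pow A \<approx> (UNIV :: 'u set)"
    using fin finA by (auto simp: lesspoll_def lepoll_iff_card_le)
  then have "card (Pow A) < card (UNIV :: 'u set)"
    using fin finA by (simp add: eqpoll_iff_card le_neq_implies_less)
  then show False
    using card finA less_exp [of "card A"] by (simp add: card_Pow)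
qed

lemma small_subset: "small B \<Longrightarrow> A \<subseteq> B \<Longrightarrow> small A"
  unfolding small_def by (rule lesspoll_trans1 [OF subset_imp_lepoll])

lemma small_image:
  fixes f :: "'u \<Rightarrow> 'u"
  shows "small A \<Longrightarrow> small (f ` A)"
  unfolding small_def by (rule lesspoll_trans1 [OF image_lepoll])

lemma subtopology_in_Top: "X \<in> Top \<Longrightarrow> subtopology X S \<in> Top"
  by (auto simp: Top_def intro: small_subset)

lemma surjective_image_in_Top:
  fixes X Y :: "'u topology"
  shows "small (topspace X) \<Longrightarrow> f ` topspace X = topspace Y \<Longrightarrow> Y \<in> Top"
  by (metis (mono_tags) Top_def mem_Collect_eq small_image)

lemma subcategory_closed_homeomorphic:
  "subcategory C \<Longrightarrow> X \<in> C \<Longrightarrow> Y \<in> Top \<Longrightarrow> X homeomorphic_space Y \<Longrightarrow> Y \<in> C"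
  unfolding subcategory_def by blast

context
  assumes univ: "universe TYPE('u)"
begin

lemma finite_imp_small:
  fixes A :: "'u set"
  shows "finite A \<Longrightarrow> small A"
  unfolding small_def using infinite_universe [OF univ] by (simp add: finite_lesspoll_infinite)

lemma finite_imp_Top:
  fixes X :: "'u topology"
  shows "finite (topspace X) \<Longrightarrow> X \<in> Top"
  by (simp add: Top_def finite_imp_small)

lemma obtain_distinct:
  obtains a b c :: 'u where "a \<noteq> b" "a \<noteq> c" "b \<noteq> c"
proof -
  note new = ex_new_if_finite [OF infinite_universe [OF univ]]
  obtain a :: 'u where True by simp
  moreover obtain b where "b \<notin> {a}" using new [of "{a}"] by auto
  moreover obtain c where "c \<notin> {a, b}" using new [of "{a, b}"] by auto
  ultimately show thesis using that [of a b c] by auto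
qed

text \<open>Every function into an indiscrete space is continuous, so the constant \<open>a\<close>
  and the function with value \<open>a\<close> on the image and \<open>b\<close> off it are test
  morphisms. They agree after \<open>f\<close>, hence everywhere if \<open>f\<close> is epi, and
  then nothing lies off the image.\<close>

lemma epimorphism_iff:
  fixes X Y :: "'u topology"
  shows "epimorphism X Y f \<longleftrightarrow> continuous_map X Y f \<and> f ` topspace X = topspace Y"
proof
  assume f: "epimorphism X Y f"
  then have cont: "continuous_map X Y f"
    by (simp add: epimorphism_def)
  obtain a b c :: 'u where ab: "a \<noteq> b" by (rule obtain_distinct)
  let ?Z = "indiscrete_topology {a, b}"
  let ?h = "\<lambda>y. if y \<in> f ` topspace X then a else b"
  have "\<forall>y\<in>topspace Y. a = ?h y"
    using f finite_imp_Top [of ?Z] unfolding epimorphism_def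
    by (elim conjE ballE [of _ _ ?Z] allE [of _ "\<lambda>_. a"] allE [of _ ?h]) auto
  then have "topspace Y \<subseteq> f ` topspace X"
    using ab by (auto split: if_splits)
  then show "continuous_map X Y f \<and> f ` topspace X = topspace Y"
    using cont continuous_map_image_subset_topspace by blast
next
  assume "continuous_map X Y f \<and> f ` topspace X = topspace Y"
  then show "epimorphism X Y f"
    unfolding epimorphism_def by (metis imageE)
qed

text \<open>Points of \<open>X\<close> are morphisms from a one-point space, so cancelling
  \<open>f\<close> on the left against such test spaces already gives injectivity.\<close>

lemma monomorphism_iff:
  fixes X Y :: "'u topology"
  shows "monomorphism X Y f \<longleftrightarrow> continuous_map X Y f \<and> inj_on f (topspace X)"
proof
  assume f: "monomorphism X Y f"
  have "x = y" if "x \<in> topspace X" "y \<in> topspace X" "f x = f y" for x y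
  proof -
    let ?Z = "indiscrete_topology {x}"
    have "continuous_map ?Z X (\<lambda>_. x)" "continuous_map ?Z X (\<lambda>_. y)" "?Z \<in> Top"
      using that finite_imp_Top by auto
    then have "\<forall>z\<in>topspace ?Z. x = y"
      using f that(3) unfolding monomorphism_def by blast
    then show ?thesis by simp
  qed
  then show "continuous_map X Y f \<and> inj_on f (topspace X)"
    using f by (auto simp: monomorphism_def inj_on_def)
next
  assume f: "continuous_map X Y f \<and> inj_on f (topspace X)"
  have "g z = h z" if "continuous_map Z X g" "continuous_map Z X h" "z \<in> topspace Z"
    "f (g z) = f (h z)" for Z :: "'u topology" and g h z
  proof -
    have "g z \<in> topspace X" "h z \<in> topspace X"
      using that(1-3) continuous_map_image_subset_topspace by blast+
    then show ?thesis
      using f that(4) by (auto dest: inj_onD)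
  qed
  then show "monomorphism X Y f"
    using f unfolding monomorphism_def by blast
qed

lemma bimorphism_iff:
  fixes X Y :: "'u topology"
  shows "bimorphism X Y f \<longleftrightarrow> continuous_map X Y f \<and> bij_betw f (topspace X) (topspace Y)"
  by (auto simp: bimorphism_def monomorphism_iff epimorphism_iff bij_betw_def)

text \<open>An extremal monomorphism factors through its image with a surjective first factor, which
  must then be a homeomorphism; smallness of \<open>X\<close> makes the image an admissible test
  object. Conversely, the inverse \<open>k\<close> of an embedding on its image yields an inverse of
  any epimorphic first factor.\<close>

lemma extremal_monomorphism_iff:
  fixes X Y :: "'u topology"
  assumes "X \<in> Top"
  shows "extremal_monomorphism X Y m \<longleftrightarrow> embedding_map X Y m"
proof
  assume m: "extremal_monomorphism X Y m"
  then have cont: "continuous_map X Y m"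
    by (simp add: extremal_monomorphism_def monomorphism_def)
  let ?Z = "subtopology Y (m ` topspace X)"
  have top: "topspace ?Z = m ` topspace X"
    using cont continuous_map_image_subset_topspace by fastforce
  then have "?Z \<in> Top"
    using assms surjective_image_in_Top by (metis (mono_tags) Top_def mem_Collect_eq)
  moreover have "epimorphism X ?Z m"
    using cont top by (simp add: epimorphism_iff continuous_map_into_subtopology)
  moreover have "continuous_map ?Z Y id"
    by (simp add: continuous_map_from_subtopology)
  ultimately have "homeomorphic_map X ?Z m"
    using m unfolding extremal_monomorphism_def by (metis id_apply)
  then show "embedding_map X Y m"
    by (simp add: embedding_map_def)
next
  assume m: "embedding_map X Y m"
  let ?Z = "subtopology Y (m ` topspace X)"
  have h: "homeomorphic_map X ?Z m"
    using m by (simp add: embedding_map_def)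
  then have inj: "inj_on m (topspace X)"
    by (rule homeomorphic_imp_injective_map)
  obtain k where k: "homeomorphic_maps X ?Z m k"
    using h homeomorphic_map_maps by blast
  have "homeomorphic_map X Z e"
    if e: "epimorphism X Z e" and f: "continuous_map Z Y f" and mfe: "\<forall>x\<in>topspace X. m x = f (e x)"
    for Z :: "'u topology" and e f
  proof -
    have e': "continuous_map X Z e" "e ` topspace X = topspace Z"
      using e by (auto simp: epimorphism_iff)
    \<comment> \<open>As \<open>e\<close> is onto, every value of \<open>f\<close> is a value of
      \<open>m\<close>. Hence \<open>k\<close> can be applied after \<open>f\<close>, giving a left
      inverse of \<open>e\<close>, which surjectivity of \<open>e\<close> makes two-sided.\<close>
    then have "f \<in> topspace Z \<rightarrow> m ` topspace X"
      using mfe by (auto simp flip: e'(2))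
    then have "continuous_map Z ?Z f"
      using f by (simp add: continuous_map_into_subtopology)
    then have "continuous_map Z X (k \<circ> f)"
      using k by (auto simp: homeomorphic_maps_def intro: continuous_map_compose)
    moreover have "(k \<circ> f) (e x) = x" if "x \<in> topspace X" for x
      using that k mfe by (metis comp_apply homeomorphic_maps_def)
    moreover from this have "e ((k \<circ> f) z) = z" if "z \<in> topspace Z" for z
      using that e'(2) by (metis imageE)
    ultimately have "homeomorphic_maps X Z e (k \<circ> f)"
      using e' by (simp add: homeomorphic_maps_def)
    then show ?thesis
      using homeomorphic_map_maps by blast
  qed
  moreover have "continuous_map X Y m"
    using h homeomorphic_imp_continuous_map continuous_map_in_subtopology by blast
  ultimately show "extremal_monomorphism X Y m"
    using inj unfolding extremal_monomorphism_def monomorphism_iff by blast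
qed

lemma closed_under_extremal_subobjects_iff:
  fixes C :: "'u topology set"
  shows "closed_under_extremal_subobjects C \<longleftrightarrow>
    (\<forall>X\<in>C. \<forall>S\<in>Top. \<forall>m. embedding_map S X m \<longrightarrow> S \<in> C)"
  unfolding closed_under_extremal_subobjects_def using extremal_monomorphism_iff by blast

lemma closed_under_bimorphic_images_iff:
  fixes C :: "'u topology set"
  shows "closed_under_images bimorphism C \<longleftrightarrow>
    (\<forall>X\<in>C. \<forall>Y\<in>Top. \<forall>f. continuous_map X Y f \<and> bij_betw f (topspace X) (topspace Y) \<longrightarrow> Y \<in> C)"
  unfolding closed_under_images_def bimorphism_iff by blast

lemma subtopology_closed:
  fixes C :: "'u topology set"
  assumes "subcategory C" "closed_under_extremal_subobjects C" "X \<in> C"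
  shows "subtopology X S \<in> C"
proof -
  have "X \<in> Top"
    using assms by (auto simp: subcategory_def)
  moreover have "embedding_map (subtopology X S) X id"
    by (simp add: embedding_map_def subtopology_restrict)
  ultimately show ?thesis
    using assms(2,3) subtopology_in_Top closed_under_extremal_subobjects_iff by blast
qed

section \<open>Epireflective subcategories\<close>

text \<open>Both \<open>h\<close> and the identity extend \<open>r\<close> along itself, so the
  uniqueness half of the universal property identifies them.\<close>

lemma reflection_arrow_endomorphism:
  assumes "reflection_arrow C X R r" "continuous_map R R h"
    and "\<And>x. x \<in> topspace X \<Longrightarrow> h (r x) = r x" "y \<in> topspace R"
  shows "h y = y"
proof -
  have "R \<in> C" "continuous_map X R r"
    using assms(1) by (simp_all add: reflection_arrow_def)
  then obtain g where g: "\<forall>k. continuous_map R R k \<and> (\<forall>x\<in>topspace X. k (r x) = r x) \<longrightarrow>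
      (\<forall>y\<in>topspace R. k y = g y)"
    using assms(1) unfolding reflection_arrow_def by blast
  have "continuous_map R R (\<lambda>y. y)"
    by simp
  then have "y = g y"
    using g assms(4) by blast
  moreover have "h y = g y"
    using g assms(2-4) by blast
  ultimately show ?thesis
    by simp
qed

text \<open>The extremal monomorphism \<open>m\<close> out of \<open>S\<close> factors through the
  reflection arrow \<open>r\<close> of \<open>S\<close>. Since \<open>r\<close> is epi, extremality
  turns it into a homeomorphism, so \<open>S\<close> is isomorphic to an object of
  \<open>C\<close>.\<close>

lemma epireflective_imp_closed_under_extremal_subobjects:
  fixes C :: "'u topology set"
  assumes C: "subcategory C" "epireflective C"
  shows "closed_under_extremal_subobjects C"
  unfolding closed_under_extremal_subobjects_def
proof (intro ballI impI)
  fix X S assume XS: "X \<in> C" "S \<in> Top" "\<exists>m. extremal_monomorphism S X m"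
  then obtain m where m: "extremal_monomorphism S X m" by blast
  obtain R r where r: "reflection_arrow C S R r" "epimorphism S R r"
    using C XS by (meson epireflective_def reflective_def)
  have "continuous_map S X m"
    using m by (simp add: extremal_monomorphism_def monomorphism_def)
  then obtain g where g: "continuous_map R X g" "\<forall>x\<in>topspace S. g (r x) = m x"
    using r(1) XS unfolding reflection_arrow_def by blast
  have R: "R \<in> C" "R \<in> Top"
    using r(1) C(1) by (auto simp: reflection_arrow_def subcategory_def)
  have "homeomorphic_map S R r"
    using m r(2) g R(2) unfolding extremal_monomorphism_def by metis
  then show "S \<in> C"
    using subcategory_closed_homeomorphic [OF C(1) R(1) XS(2)] homeomorphic_map_imp_homeomorphic_space
      homeomorphic_space_sym by blast
qed

text \<open>The projections of the product extend along its reflection arrow \<open>r\<close>, and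
  the extensions combine to a left inverse \<open>s\<close> of \<open>r\<close>. The composite of
  \<open>s\<close> followed by \<open>r\<close> fixes the values of \<open>r\<close>, so it is the
  identity and \<open>r\<close> is a homeomorphism.\<close>

lemma reflective_imp_closed_under_products:
  fixes C :: "'u topology set"
  assumes C: "subcategory C" "reflective C"
  shows "closed_under_products C"
  unfolding closed_under_products_def
proof (intro allI ballI impI)
  fix I :: "'u set" and X :: "'u \<Rightarrow> 'u topology" and P :: "'u topology"
  assume P: "P \<in> Top"
    and *: "small I \<and> (\<forall>i\<in>I. X i \<in> C) \<and> P homeomorphic_space product_topology X I"
  let ?Q = "product_topology X I"
  obtain u v where uv: "homeomorphic_maps P ?Q u v"
    using * homeomorphic_space_def by blast
  obtain R r where r: "reflection_arrow C P R r"
    using C(2) P by (meson reflective_def)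
  then have rc: "continuous_map P R r" and R: "R \<in> C"
    by (auto simp: reflection_arrow_def)
  have "\<exists>g. continuous_map R (X i) g \<and> (\<forall>x\<in>topspace P. g (r x) = u x i)" if "i \<in> I" for i
  proof -
    have "continuous_map P (X i) (\<lambda>x. u x i)"
      using uv that unfolding homeomorphic_maps_def
      by (auto simp: continuous_map_componentwise)
    then show ?thesis
      using r * that unfolding reflection_arrow_def by blast
  qed
  then obtain g where g: "\<And>i. i \<in> I \<Longrightarrow> continuous_map R (X i) (g i)"
    "\<And>i x. i \<in> I \<Longrightarrow> x \<in> topspace P \<Longrightarrow> g i (r x) = u x i"
    by metis
  \<comment> \<open>The extensions give a point of the product of functions; \<open>v\<close>
    carries it back to the small copy \<open>P\<close>.\<close>
  define s where "s = v \<circ> (\<lambda>y. \<lambda>i\<in>I. g i y)"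
  have "continuous_map R ?Q (\<lambda>y. \<lambda>i\<in>I. g i y)"
    using g(1) by (auto simp: continuous_map_componentwise)
  then have s: "continuous_map R P s"
    using uv by (auto simp: s_def homeomorphic_maps_def intro: continuous_map_compose)
  have sr: "s (r x) = x" if "x \<in> topspace P" for x
  proof -
    have "u x \<in> topspace ?Q"
      using uv that by (auto simp: homeomorphic_maps_def continuous_map_def)
    then have "(\<lambda>i\<in>I. g i (r x)) = u x"
      using g(2) that by (auto simp: PiE_def extensional_def fun_eq_iff)
    then show ?thesis
      using uv that by (simp add: s_def homeomorphic_maps_def)
  qed
  have "continuous_map R R (r \<circ> s)"
    using s rc continuous_map_compose by blast
  from reflection_arrow_endomorphism [OF r this] sr
  have "(r \<circ> s) y = y" if "y \<in> topspace R" for y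
    using that by simp
  then have "homeomorphic_maps P R r s"
    using rc s sr by (auto simp: homeomorphic_maps_def)
  then show "P \<in> C"
    using subcategory_closed_homeomorphic [OF C(1) R P] homeomorphic_space_sym homeomorphic_space_def
    by blast
qed

text \<open>The image of \<open>r\<close> is a subspace of \<open>R\<close>, hence in
  \<open>C\<close>, so \<open>r\<close> with restricted codomain extends to a map \<open>g\<close>
  from \<open>R\<close> onto values in that image. Viewed as an endomorphism of \<open>R\<close>,
  \<open>g\<close> fixes the values of \<open>r\<close> and is the identity; thus the image is all
  of \<open>R\<close>.\<close>

lemma reflective_imp_epireflective:
  fixes C :: "'u topology set"
  assumes C: "subcategory C" "closed_under_extremal_subobjects C" "reflective C"
  shows "epireflective C"
  unfolding epireflective_def
proof (intro conjI ballI allI impI)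
  fix X R r assume r: "reflection_arrow C X R r"
  then have rc: "continuous_map X R r" and R: "R \<in> C"
    by (auto simp: reflection_arrow_def)
  let ?S = "subtopology R (r ` topspace X)"
  have "continuous_map X ?S r"
    using rc by (simp add: continuous_map_into_subtopology)
  then obtain g where g: "continuous_map R ?S g" "\<forall>x\<in>topspace X. g (r x) = r x"
    using r subtopology_closed [OF C(1,2) R] unfolding reflection_arrow_def by blast
  then have gR: "continuous_map R R g"
    using continuous_map_in_subtopology by blast
  have "g y = y" if "y \<in> topspace R" for y
    using reflection_arrow_endomorphism [OF r gR _ that] g(2) by blast
  moreover have "g y \<in> r ` topspace X" if "y \<in> topspace R" for y
    using g(1) that by (auto simp: continuous_map_in_subtopology)
  ultimately have "topspace R \<subseteq> r ` topspace X"
    by force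
  then show "epimorphism X R r"
    using rc continuous_map_image_subset_topspace by (fastforce simp: epimorphism_iff)
qed (rule C(3))

section \<open>The three classes\<close>

text \<open>The finiteness clause in the definition excludes infinite carriers, to which
  \<open>card\<close> assigns 0. Membership in \<open>Top\<close> comes for free because finite sets
  are small.\<close>

lemma subsingleton_spaces_iff:
  fixes X :: "'u topology"
  shows "X \<in> subsingleton_spaces \<longleftrightarrow> (\<forall>x\<in>topspace X. \<forall>y\<in>topspace X. x = y)"
proof -
  have "finite (topspace X) \<and> card (topspace X) \<le> 1 \<longleftrightarrow> (\<forall>x\<in>topspace X. \<forall>y\<in>topspace X. x = y)"
    by (metis card_le_Suc0_iff_eq One_nat_def finite.emptyI finite.insertI insertI1 is_singletonI'
        is_singleton_def)
  then show ?thesis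
    using finite_imp_Top by (auto simp: subsingleton_spaces_def)
qed

lemma three_classes_subset_Top:
  "subsingleton_spaces \<subseteq> Top" "indiscrete_spaces \<subseteq> Top"
  by (auto simp: subsingleton_spaces_def indiscrete_spaces_def)

text \<open>Treating subspaces up to homeomorphism serves two purposes: embeddings give closedness
  under extremal subobjects, and the choice of \<open>UNIV\<close> for \<open>S\<close> gives
  closedness under isomorphism.\<close>

lemma indiscrete_spacesI:
  fixes X Y :: "'u topology"
  assumes "Y \<in> indiscrete_spaces" "X \<in> Top" "X homeomorphic_space subtopology Y S"
  shows "X \<in> indiscrete_spaces"
proof -
  obtain f where f: "homeomorphic_map X (subtopology Y S) f"
    using assms(3) homeomorphic_space by blast
  have "U = {} \<or> U = topspace X" if U: "openin X U" for U
  proof -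
    have "openin (subtopology Y S) (f ` U)"
      using f U homeomorphic_map_openness openin_subset by blast
    then have "f ` U = {} \<or> f ` U = topspace (subtopology Y S)"
      using assms(1) by (auto simp: openin_subtopology indiscrete_spaces_def)
    then show ?thesis
      using f U openin_subset [OF U]
      by (metis homeomorphic_imp_injective_map homeomorphic_imp_surjective_map image_is_empty
          inj_on_image_eq_iff order_refl)
  qed
  then show ?thesis
    using assms(2) by (simp add: indiscrete_spaces_def)
qed

lemma subcategory_three_classes:
  "subcategory (subsingleton_spaces :: 'u topology set)"
  "subcategory (indiscrete_spaces :: 'u topology set)"
  "subcategory (Top :: 'u topology set)"
proof -
  have "Y \<in> subsingleton_spaces" if X: "X \<in> subsingleton_spaces" and Y: "X homeomorphic_space Y"
    for X Y :: "'u topology"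
  proof -
    obtain f where "homeomorphic_map X Y f"
      using Y unfolding homeomorphic_space by blast
    then have "topspace Y = f ` topspace X"
      by (simp add: homeomorphic_imp_surjective_map)
    then show ?thesis
      using X by (auto simp: subsingleton_spaces_iff)
  qed
  then show "subcategory (subsingleton_spaces :: 'u topology set)"
    unfolding subcategory_def using three_classes_subset_Top by blast
  have "Y \<in> indiscrete_spaces"
    if "X \<in> indiscrete_spaces" "Y \<in> Top" "X homeomorphic_space Y" for X Y :: "'u topology"
    using that indiscrete_spacesI [of X Y UNIV] homeomorphic_space_sym [of X Y] by simp
  then show "subcategory (indiscrete_spaces :: 'u topology set)"
    unfolding subcategory_def using three_classes_subset_Top by blast
qed (simp add: subcategory_def)

lemma closed_under_extremal_subobjects_three_classes:
  "closed_under_extremal_subobjects (subsingleton_spaces :: 'u topology set)"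
  "closed_under_extremal_subobjects (indiscrete_spaces :: 'u topology set)"
  "closed_under_extremal_subobjects (Top :: 'u topology set)"
proof -
  have "S \<in> subsingleton_spaces" if "X \<in> subsingleton_spaces" and m: "extremal_monomorphism S X m"
    for X S :: "'u topology" and m
  proof -
    have "m ` topspace S \<subseteq> topspace X" "inj_on m (topspace S)"
      using m continuous_map_image_subset_topspace
      unfolding extremal_monomorphism_def monomorphism_iff by blast+
    then show ?thesis
      using that(1) unfolding subsingleton_spaces_iff
      by (meson image_subset_iff inj_onD)
  qed
  then show "closed_under_extremal_subobjects (subsingleton_spaces :: 'u topology set)"
    unfolding closed_under_extremal_subobjects_def by blast
  show "closed_under_extremal_subobjects (indiscrete_spaces :: 'u topology set)"
    unfolding closed_under_extremal_subobjects_iff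
    using embedding_map_imp_homeomorphic_space indiscrete_spacesI by blast
qed (simp add: closed_under_extremal_subobjects_def)

lemma closed_under_bimorphic_images_three_classes:
  "closed_under_images bimorphism (subsingleton_spaces :: 'u topology set)"
  "closed_under_images bimorphism (indiscrete_spaces :: 'u topology set)"
  "closed_under_images bimorphism (Top :: 'u topology set)"
proof -
  have "Y \<in> subsingleton_spaces"
    if "X \<in> subsingleton_spaces" and "bij_betw f (topspace X) (topspace Y)"
    for X Y :: "'u topology" and f
    using that unfolding subsingleton_spaces_iff bij_betw_def by (metis imageE)
  then show "closed_under_images bimorphism (subsingleton_spaces :: 'u topology set)"
    unfolding closed_under_bimorphic_images_iff by blast
  have "Y \<in> indiscrete_spaces"
    if X: "X \<in> indiscrete_spaces" and Y: "Y \<in> Top"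
      and f: "continuous_map X Y f" "bij_betw f (topspace X) (topspace Y)"
    for X Y :: "'u topology" and f
  proof -
    have surj: "f ` topspace X = topspace Y"
      using f(2) by (simp add: bij_betw_def)
    have "V = {} \<or> V = topspace Y" if V: "openin Y V" for V
    proof -
      \<comment> \<open>The preimage of \<open>V\<close> is trivial because \<open>X\<close> is
        indiscrete, and surjectivity recovers \<open>V\<close> as the image of its preimage.\<close>
      define W where "W = {x \<in> topspace X. f x \<in> V}"
      have "openin X W"
        unfolding W_def using f(1) V by (rule openin_continuous_map_preimage)
      then have "W = {} \<or> W = topspace X"
        using X by (simp add: indiscrete_spaces_def)
      moreover have "V = f ` W"
        using openin_subset [OF V] by (auto simp: W_def simp flip: surj)
      ultimately show ?thesis
        using surj by auto
    qed
    then show ?thesis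
      using Y by (simp add: indiscrete_spaces_def)
  qed
  then show "closed_under_images bimorphism (indiscrete_spaces :: 'u topology set)"
    unfolding closed_under_bimorphic_images_iff by blast
qed (simp add: closed_under_images_def)

text \<open>The reflections are, in turn, the collapse of a nonempty space to a point, the identity
  onto the indiscrete topology on the same set, and the identity. In the first class the empty space
  is its own reflection, since a one-point space has no map to it.\<close>

lemma reflective_three_classes:
  "reflective (subsingleton_spaces :: 'u topology set)"
  "reflective (indiscrete_spaces :: 'u topology set)"
  "reflective (Top :: 'u topology set)"
proof -
  have "\<exists>R r. reflection_arrow subsingleton_spaces X R r" for X :: "'u topology"
  proof (cases "topspace X = {}")
    case True
    then have "X \<in> subsingleton_spaces"
      by (simp add: subsingleton_spaces_iff)
    then have "reflection_arrow subsingleton_spaces X X id"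
      by (auto simp: reflection_arrow_def)
    then show ?thesis by blast
  next
    case False
    then obtain p where p: "p \<in> topspace X" by blast
    let ?R = "discrete_topology {p}"
    have "\<exists>g. continuous_map ?R D g \<and> (\<forall>x\<in>topspace X. g p = f x) \<and>
        (\<forall>h. continuous_map ?R D h \<and> (\<forall>x\<in>topspace X. h p = f x) \<longrightarrow> (\<forall>y\<in>topspace ?R. h y = g y))"
      if "D \<in> subsingleton_spaces" "continuous_map X D f" for D :: "'u topology" and f
    proof (intro exI conjI)
      have f: "f \<in> topspace X \<rightarrow> topspace D"
        using that(2) by (simp add: continuous_map_def)
      \<comment> \<open>Because the single point \<open>p\<close> of the reflection was taken from
        \<open>X\<close>, the map \<open>f\<close> itself serves as the extension.\<close>
      show "continuous_map ?R D f"
        using f p by auto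
      show "\<forall>x\<in>topspace X. f p = f x"
        using f p that(1) unfolding subsingleton_spaces_iff by blast
      show "\<forall>h. continuous_map ?R D h \<and> (\<forall>x\<in>topspace X. h p = f x) \<longrightarrow> (\<forall>y\<in>topspace ?R. h y = f y)"
        using p by auto
    qed
    then have "reflection_arrow subsingleton_spaces X ?R (\<lambda>_. p)"
      by (simp add: reflection_arrow_def subsingleton_spaces_iff)
    then show ?thesis by blast
  qed
  then show "reflective (subsingleton_spaces :: 'u topology set)"
    by (simp add: reflective_def)
  have "reflection_arrow indiscrete_spaces X (indiscrete_topology (topspace X)) id"
    if "X \<in> Top" for X :: "'u topology"
    unfolding reflection_arrow_def
  proof (intro conjI ballI allI impI)
    show "indiscrete_topology (topspace X) \<in> indiscrete_spaces"
      using that by (simp add: indiscrete_spaces_def Top_def)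
    fix D :: "'u topology" and f assume D: "D \<in> indiscrete_spaces" and f: "continuous_map X D f"
    \<comment> \<open>In this form, continuity into \<open>D\<close> only requires that carriers be
      mapped into carriers, so \<open>f\<close> stays continuous on the coarser domain.\<close>
    obtain A where "D = indiscrete_topology A"
    proof
      show "D = indiscrete_topology (topspace D)"
        using D by (auto simp: topology_eq indiscrete_spaces_def)
    qed
    then have "continuous_map (indiscrete_topology (topspace X)) D f"
      using f by simp
    then show "\<exists>g. continuous_map (indiscrete_topology (topspace X)) D g \<and>
        (\<forall>x\<in>topspace X. g (id x) = f x) \<and>
        (\<forall>h. continuous_map (indiscrete_topology (topspace X)) D h \<and>
          (\<forall>x\<in>topspace X. h (id x) = f x) \<longrightarrow>
          (\<forall>y\<in>topspace (indiscrete_topology (topspace X)). h y = g y))"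
      by (intro exI [of _ f]) simp
  qed simp
  then show "reflective (indiscrete_spaces :: 'u topology set)"
    unfolding reflective_def by blast
  have "reflection_arrow Top X X id" if "X \<in> Top" for X :: "'u topology"
    using that by (auto simp: reflection_arrow_def)
  then show "reflective (Top :: 'u topology set)"
    unfolding reflective_def by blast
qed

lemma epireflective_three_classes:
  "epireflective (subsingleton_spaces :: 'u topology set)"
  "epireflective (indiscrete_spaces :: 'u topology set)"
  "epireflective (Top :: 'u topology set)"
  using subcategory_three_classes closed_under_extremal_subobjects_three_classes
    reflective_three_classes reflective_imp_epireflective by blast+

section \<open>Classes with the three closure properties\<close>

text \<open>The points of a product are functions, so closedness under products speaks only of its
  copies in \<open>Top\<close>. If the carrier is smaller than the universe, an injection
  \<open>e\<close> provides such a copy \<open>P\<close>, and \<open>X\<close> embeds into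
  \<open>P\<close> through the product.\<close>

lemma closed_under_product_subspaces:
  fixes C :: "'u topology set" and I :: "'u set"
  assumes C: "closed_under_products C" "closed_under_extremal_subobjects C"
    and Y: "small I" "\<And>i. i \<in> I \<Longrightarrow> Y i \<in> C"
      "topspace (product_topology Y I) \<prec> (UNIV :: 'u set)"
    and X: "X \<in> Top" "embedding_map X (product_topology Y I) f"
  shows "X \<in> C"
proof -
  let ?Q = "product_topology Y I"
  obtain e :: "_ \<Rightarrow> 'u" where e: "inj_on e (topspace ?Q)"
    using Y(3) by (auto simp: lesspoll_def lepoll_def)
  then obtain P where P: "topspace P = e ` topspace ?Q" "homeomorphic_map ?Q P e"
    by (rule homeomorphic_map_onto_injective_image)
  have "P \<in> Top"
    using Y(3) e by (simp add: Top_def small_def P(1))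
  moreover have "P homeomorphic_space ?Q"
    using P(2) homeomorphic_map_imp_homeomorphic_space homeomorphic_space_sym by blast
  ultimately have "P \<in> C"
    by (intro C(1) [unfolded closed_under_products_def, rule_format, of P I Y]) (use Y in auto)
  moreover have "embedding_map ?Q P e"
    using P(2) unfolding embedding_map_def P(1) [symmetric] subtopology_topspace .
  then have "embedding_map X P (e \<circ> f)"
    using X(2) embedding_map_compose by blast
  ultimately show ?thesis
    using C(2) X(1) closed_under_extremal_subobjects_iff by blast
qed

text \<open>The empty product is a one-point space, and every space with at most one point, the
  empty space included, embeds into it.\<close>

lemma subsingleton_spaces_subset:
  fixes C :: "'u topology set"
  assumes C: "closed_under_products C" "closed_under_extremal_subobjects C"
  shows "subsingleton_spaces \<subseteq> C"
proof
  fix X :: "'u topology" assume X: "X \<in> subsingleton_spaces"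
  \<comment> \<open>Over the empty index set the family has no factors, so \<open>X\<close> is only
    a placeholder.\<close>
  define Q where "Q = product_topology (\<lambda>i :: 'u. X) {}"
  have Q: "topspace Q = {\<lambda>_. undefined}"
    by (simp add: Q_def)
  have "embedding_map X Q (\<lambda>_ _. undefined)"
  proof (rule injective_open_imp_embedding_map)
    show "open_map X Q (\<lambda>_ _. undefined)"
      unfolding open_map_def Q_def
      by (auto simp: openin_product_topology_empty)
    show "inj_on (\<lambda>_ _. undefined) (topspace X)"
      using X unfolding subsingleton_spaces_iff inj_on_def by blast
  qed (simp add: Q)
  moreover have "topspace Q \<prec> (UNIV :: 'u set)"
    unfolding Q by (simp add: finite_lesspoll_infinite infinite_universe [OF univ])
  moreover have "X \<in> Top"
    using X by (simp add: subsingleton_spaces_def)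
  ultimately show "X \<in> C"
    using closed_under_product_subspaces [OF C, of "{}" "\<lambda>i. X"] finite_imp_small
    unfolding Q_def by blast
qed

text \<open>The embedding into a product of two-point spaces is carried out inside the universe;
  what has to be checked is that index set and product are small and that the factors lie in
  \<open>C\<close>.\<close>

lemma closed_under_two_point_products:
  fixes C :: "'u topology set"
  assumes C: "closed_under_products C" "closed_under_extremal_subobjects C"
    and ab: "a \<noteq> b" "indiscrete_topology {a, b} \<in> C"
    and X: "X \<in> Top" "sierpinski_topology a b \<in> C \<or> X \<in> indiscrete_spaces"
  shows "X \<in> C"
proof -
  have "Pow (topspace X) \<prec> (UNIV :: 'u set)"
    using univ X(1) by (simp add: universe_def Top_def)
  moreover from this obtain h :: "'u set \<Rightarrow> 'u" where h: "inj_on h (Pow (topspace X))"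
    by (auto simp: lesspoll_def lepoll_def)
  \<comment> \<open>Index sets must consist of elements of the universe, so the subsets of
    \<open>X\<close> are coded by \<open>h\<close>; \<open>D\<close> decodes them.\<close>
  define J where "J = h ` Pow (topspace X)"
  ultimately have J: "small J"
    using h by (simp add: small_def)
  define D where "D = inv_into (Pow (topspace X)) h"
  have D: "D ` J = Pow (topspace X)"
    unfolding D_def J_def by (rule inv_into_image_cancel [OF h]) simp
  define Y where "Y = (\<lambda>i. if openin X (D i) \<and> D i \<noteq> {} \<and> D i \<noteq> topspace X
      then sierpinski_topology a b else indiscrete_topology {a, b})"
  have "topspace (product_topology Y J) = (\<Pi>\<^sub>E i\<in>J. {a, b})"
    by (simp add: Y_def if_distrib [of topspace] cong: if_cong)
  \<comment> \<open>Closedness under power sets is applied a second time, now to the index set, to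
    bound the carrier of the product.\<close>
  moreover have "Pow J \<prec> (UNIV :: 'u set)"
    using univ J by (simp add: universe_def)
  ultimately have Q: "topspace (product_topology Y J) \<prec> (UNIV :: 'u set)"
    using PiE_doubleton_lepoll_Pow lesspoll_trans1 by metis
  \<comment> \<open>A Sierpinski factor arises only from a nontrivial open set, so an indiscrete
    \<open>X\<close> has only indiscrete factors.\<close>
  have "Y i \<in> C" for i
    using ab(2) X(2) by (auto simp: Y_def indiscrete_spaces_def)
  then show ?thesis
    using closed_under_product_subspaces [OF C J _ Q X(1)]
      embedding_map_into_two_point_product [OF ab(1) D, folded Y_def] by blast
qed

text \<open>The identity from a two-point subspace to a coarser topology on the same two points is a
  bimorphism. The indiscrete topology is always coarser, and the Sierpinski topology is coarser as
  soon as {a} is open in the subspace.\<close>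

lemma two_point_images:
  fixes C :: "'u topology set"
  assumes C: "subcategory C" "closed_under_extremal_subobjects C" "closed_under_images bimorphism C"
    and X: "X \<in> C" "a \<in> topspace X" "b \<in> topspace X" "a \<noteq> b"
  shows "indiscrete_topology {a, b} \<in> C"
    and "openin X U \<Longrightarrow> a \<in> U \<Longrightarrow> b \<notin> U \<Longrightarrow> sierpinski_topology a b \<in> C"
proof -
  let ?S = "subtopology X {a, b}"
  have S: "?S \<in> C" "topspace ?S = {a, b}"
    using subtopology_closed [OF C(1,2) X(1)] X by auto
  have image: "T \<in> C" if "topspace T = {a, b}" "continuous_map ?S T id" for T
    using that S C(3) finite_imp_Top [of T] unfolding closed_under_bimorphic_images_iff
    by (metis bij_betw_id finite.emptyI finite_insert)
  show "indiscrete_topology {a, b} \<in> C"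
    using S by (intro image) auto
  assume U: "openin X U" "a \<in> U" "b \<notin> U"
  then have "{a} = U \<inter> {a, b}"
    by auto
  then have a: "openin ?S {a}"
    using U(1) openin_subtopology by blast
  have "continuous_map ?S (sierpinski_topology a b) id"
    unfolding continuous_map_def
  proof (intro conjI allI impI)
    show "id \<in> topspace ?S \<rightarrow> topspace (sierpinski_topology a b)"
      using S(2) by auto
    fix V assume "openin (sierpinski_topology a b) V"
    then have "{x \<in> topspace ?S. id x \<in> V} = V" "V = {} \<or> V = {a} \<or> V = topspace ?S"
      using S(2) by auto
    then show "openin ?S {x \<in> topspace ?S. id x \<in> V}"
      using a by (metis openin_empty openin_topspace)
  qed
  then show "sierpinski_topology a b \<in> C"
    by (intro image) auto
qed

text \<open>Each case assumes that \<open>C\<close> lies in one of the classes and not in the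
  smaller ones considered before; a witness of the latter supplies the two-point spaces that
  generate the whole class.\<close>

lemma closure_properties_imp_three_classes:
  fixes C :: "'u topology set"
  assumes C: "subcategory C" "closed_under_products C" "closed_under_extremal_subobjects C"
    "closed_under_images bimorphism C"
  shows "C = subsingleton_spaces \<or> C = indiscrete_spaces \<or> C = Top"
proof (cases "C \<subseteq> subsingleton_spaces")
  case True
  then show ?thesis
    using subsingleton_spaces_subset [OF C(2,3)] by blast
next
  case False
  have Top: "C \<subseteq> Top"
    using C(1) by (simp add: subcategory_def)
  show ?thesis
  proof (cases "C \<subseteq> indiscrete_spaces")
    case True
    obtain X a b where "X \<in> C" "a \<in> topspace X" "b \<in> topspace X" "a \<noteq> b"
      using False by (meson subsetI subsingleton_spaces_iff)
    then have "indiscrete_topology {a, b} \<in> C"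
      using two_point_images(1) [OF C(1,3,4)] by blast
    then have "indiscrete_spaces \<subseteq> C"
      using closed_under_two_point_products [OF C(2,3) \<open>a \<noteq> b\<close>] by (auto simp: indiscrete_spaces_def)
    then show ?thesis
      using True by blast
  next
    case False
    then obtain X U where X: "X \<in> C" and U: "openin X U" "U \<noteq> {}" "U \<noteq> topspace X"
      using Top by (auto simp: indiscrete_spaces_def)
    \<comment> \<open>A nontrivial open set separates a point inside from a point outside, which
      brings the Sierpinski space with open point \<open>a\<close> into \<open>C\<close>.\<close>
    moreover from this obtain a b where ab: "a \<in> U" "b \<in> topspace X" "b \<notin> U"
      using openin_subset by blast
    moreover from this U have "a \<in> topspace X" "a \<noteq> b"
      using openin_subset by blast+
    ultimately have "indiscrete_topology {a, b} \<in> C" "sierpinski_topology a b \<in> C"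
      using two_point_images [OF C(1,3,4) X] by blast+
    then have "Top \<subseteq> C"
      using closed_under_two_point_products [OF C(2,3) \<open>a \<noteq> b\<close>] by blast
    then show ?thesis
      using Top by blast
  qed
qed

section \<open>Independence of the closure properties\<close>

text \<open>The witness is the class of spaces with at most two points: injections into such a space
  and surjections from it preserve the bound. It contains the indiscrete space with two points but
  not the one with three.\<close>

lemma products_not_redundant:
  "\<exists>D :: 'u topology set. subcategory D \<and>
    closed_under_extremal_subobjects D \<and> closed_under_images bimorphism D \<and>
    \<not> (D = subsingleton_spaces \<or> D = indiscrete_spaces \<or> D = Top)"
proof -
  define D :: "'u topology set" where "D = {X. finite (topspace X) \<and> card (topspace X) \<le> 2}"
  have inj: "X \<in> D" if "Y \<in> D" "inj_on f (topspace X)" "f ` topspace X \<subseteq> topspace Y"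
    for X Y :: "'u topology" and f
    using that unfolding D_def mem_Collect_eq
    by (meson card_inj_on_le inj_on_finite le_trans)
  have surj: "Y \<in> D" if "X \<in> D" "f ` topspace X = topspace Y" for X Y :: "'u topology" and f
    using that unfolding D_def mem_Collect_eq
    by (metis card_image_le finite_imageI le_trans)
  have "Y \<in> D" if "X \<in> D" "X homeomorphic_space Y" for X Y
    using that surj homeomorphic_space homeomorphic_imp_surjective_map by metis
  moreover have "D \<subseteq> Top"
    using finite_imp_Top by (auto simp: D_def)
  ultimately have "subcategory D"
    unfolding subcategory_def by blast
  moreover have "closed_under_extremal_subobjects D"
    unfolding closed_under_extremal_subobjects_def extremal_monomorphism_def monomorphism_iff
    using inj continuous_map_image_subset_topspace by blast
  moreover have "closed_under_images bimorphism D"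
    unfolding closed_under_bimorphic_images_iff bij_betw_def using surj by blast
  moreover have "\<not> (D = subsingleton_spaces \<or> D = indiscrete_spaces \<or> D = Top)"
  proof -
    obtain a b c :: 'u where abc: "a \<noteq> b" "a \<noteq> c" "b \<noteq> c" by (rule obtain_distinct)
    have "indiscrete_topology {a, b} \<in> D - subsingleton_spaces"
      using abc by (auto simp: D_def subsingleton_spaces_iff)
    moreover have "indiscrete_topology {a, b, c} \<in> (indiscrete_spaces \<inter> Top) - D"
      using abc finite_imp_Top by (auto simp: D_def indiscrete_spaces_def)
    ultimately show ?thesis by blast
  qed
  ultimately show ?thesis by blast
qed

text \<open>The witness is the class of nonempty small spaces. It omits the empty space, which
  belongs to all three classes.\<close>

lemma extremal_subobjects_not_redundant:
  "\<exists>D :: 'u topology set. subcategory D \<and>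
    closed_under_products D \<and> closed_under_images bimorphism D \<and>
    \<not> (D = subsingleton_spaces \<or> D = indiscrete_spaces \<or> D = Top)"
proof -
  define D :: "'u topology set" where "D = {X \<in> Top. topspace X \<noteq> {}}"
  have "subcategory D"
    unfolding subcategory_def D_def
    by (auto simp: homeomorphic_empty_space)
  moreover have "closed_under_products D"
    unfolding closed_under_products_def
  proof (intro allI ballI impI)
    fix I :: "'u set" and X :: "'u \<Rightarrow> 'u topology" and P :: "'u topology"
    assume P: "P \<in> Top"
      and *: "small I \<and> (\<forall>i\<in>I. X i \<in> D) \<and> P homeomorphic_space product_topology X I"
    then have "topspace (product_topology X I) \<noteq> {}"
      by (simp add: D_def PiE_eq_empty_iff)
    then show "P \<in> D"
      using P * homeomorphic_empty_space unfolding D_def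
      by (metis (mono_tags, lifting) homeomorphic_imp_surjective_map homeomorphic_space image_is_empty
          mem_Collect_eq)
  qed
  moreover have "closed_under_images bimorphism D"
    unfolding closed_under_bimorphic_images_iff by (auto simp: D_def bij_betw_def)
  moreover have "\<not> (D = subsingleton_spaces \<or> D = indiscrete_spaces \<or> D = Top)"
  proof -
    have "discrete_topology {} \<in> (subsingleton_spaces \<inter> indiscrete_spaces \<inter> Top) - D"
      using finite_imp_Top by (auto simp: D_def subsingleton_spaces_iff indiscrete_spaces_def)
    then show ?thesis by blast
  qed
  ultimately show ?thesis by blast
qed

text \<open>The witness is the class of small Hausdorff spaces. It contains the two-point discrete
  space but not the two-point indiscrete space, which is a bimorphic image of it.\<close>

lemma bimorphic_images_not_redundant:
  "\<exists>D :: 'u topology set. subcategory D \<and>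
    closed_under_products D \<and> closed_under_extremal_subobjects D \<and>
    \<not> (D = subsingleton_spaces \<or> D = indiscrete_spaces \<or> D = Top)"
proof -
  define D :: "'u topology set" where "D = {X \<in> Top. Hausdorff_space X}"
  have "subcategory D"
    unfolding subcategory_def D_def
    using homeomorphic_Hausdorff_space by blast
  moreover have "closed_under_products D"
    unfolding closed_under_products_def D_def
    by (auto simp: homeomorphic_Hausdorff_space Hausdorff_space_product_topology)
  moreover have "closed_under_extremal_subobjects D"
    unfolding closed_under_extremal_subobjects_iff D_def
    using embedding_map_imp_homeomorphic_space homeomorphic_Hausdorff_space Hausdorff_space_subtopology
    by blast
  moreover have "\<not> (D = subsingleton_spaces \<or> D = indiscrete_spaces \<or> D = Top)"
  proof -
    obtain a b c :: 'u where ab: "a \<noteq> b" by (rule obtain_distinct)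
    have "discrete_topology {a, b} \<in> D - subsingleton_spaces"
      using ab finite_imp_Top by (auto simp: D_def subsingleton_spaces_iff)
    moreover have "\<not> Hausdorff_space (indiscrete_topology {a, b})"
      using ab by (auto simp: Hausdorff_space_def disjnt_def)
    then have "indiscrete_topology {a, b} \<in> (indiscrete_spaces \<inter> Top) - D"
      using finite_imp_Top by (auto simp: D_def indiscrete_spaces_def)
    ultimately show ?thesis by blast
  qed
  ultimately show ?thesis by blast
qed

end

theorem theorem1:
  fixes C :: "'u topology set"
  assumes "universe TYPE('u)"
    and "subcategory C"
  shows "(epireflective C \<and> closed_under_images bimorphism C \<longleftrightarrow>
      C = subsingleton_spaces \<or> C = indiscrete_spaces \<or> C = Top) \<and>
    (epireflective C \<and> closed_under_images bimorphism C \<longleftrightarrow>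
      closed_under_products C \<and> closed_under_extremal_subobjects C \<and>
      closed_under_images bimorphism C) \<and>
    (\<exists>D :: 'u topology set. subcategory D \<and>
      closed_under_extremal_subobjects D \<and> closed_under_images bimorphism D \<and>
      \<not> (D = subsingleton_spaces \<or> D = indiscrete_spaces \<or> D = Top)) \<and>
    (\<exists>D :: 'u topology set. subcategory D \<and>
      closed_under_products D \<and> closed_under_images bimorphism D \<and>
      \<not> (D = subsingleton_spaces \<or> D = indiscrete_spaces \<or> D = Top)) \<and>
    (\<exists>D :: 'u topology set. subcategory D \<and>
      closed_under_products D \<and> closed_under_extremal_subobjects D \<and>
      \<not> (D = subsingleton_spaces \<or> D = indiscrete_spaces \<or> D = Top))"
proof (intro conjI)
  let ?three = "C = subsingleton_spaces \<or> C = indiscrete_spaces \<or> C = Top"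
  let ?closed = "closed_under_products C \<and> closed_under_extremal_subobjects C \<and>
      closed_under_images bimorphism C"
  \<comment> \<open>The three conditions are linked in a cycle: epireflectivity gives the closure
    properties, these give the classification, and each class in the classification is epireflective
    and closed under bimorphic images.\<close>
  have 1: "?closed" if "epireflective C \<and> closed_under_images bimorphism C"
    using that assms epireflective_imp_closed_under_extremal_subobjects
      reflective_imp_closed_under_products unfolding epireflective_def by blast
  have 2: ?three if ?closed
    using that assms closure_properties_imp_three_classes by blast
  have 3: "epireflective C \<and> closed_under_images bimorphism C" if ?three
    using that assms(1) epireflective_three_classes closed_under_bimorphic_images_three_classes
    by blast
  show "epireflective C \<and> closed_under_images bimorphism C \<longleftrightarrow> ?three"
    using 1 2 3 by blast
  show "epireflective C \<and> closed_under_images bimorphism C \<longleftrightarrow> ?closed"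
    using 1 2 3 by blast
qed (fact products_not_redundant [OF assms(1)] extremal_subobjects_not_redundant [OF assms(1)]
    bimorphic_images_not_redundant [OF assms(1)])+

end
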